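(* Let $\Bbbk$ be an algebraically closed field of characteristic zero and let $\mathbb B=\Bbbk[u,v,w]/(u^2w-v^2-u)$. The derivation $\mathcal D\in\operatorname{Der}_{\Bbbk}(\mathbb B)$ defined by \[ \mathcal D(w)=1,\qquad \mathcal D(u)=v+u^2w-u-u^2,\qquad \mathcal D(v)=uvw-uv+uw-\frac{v+1}{2} \] is simple.
   Context: $u,v,w$ also denote their images in $\mathbb B$. $\operatorname{Der}_{\Bbbk}(\mathbb B)$ is the space of $\Bbbk$-derivations of $\mathbb B$. A derivation $D$ of a $\Bbbk$-algebra $A$ is simple if the only ideals $I\subseteq A$ with $D(I)\subseteq I$ are $I=0$ and $I=A$. *)

theory Defs
  imports "HOL-Computational_Algebra.Computational_Algebra"
begin

text \<open>
  The polynomial ring in u, v, w over 'k is represented as the iterated polynomial ring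
  k[u][w][v], i.e. u is the innermost and v the outermost variable.  (In this order the
  relation is, up to sign, a monic polynomial in v.)
\<close>

type_synonym 'k poly3 = "'k poly poly poly"

definition const3 :: "'k::field \<Rightarrow> 'k poly3" where
  "const3 c = [:[:[:c:]:]:]"

definition poly_u :: "'k::field poly3" where
  "poly_u = [:[:[:0, 1:]:]:]"

definition poly_w :: "'k::field poly3" where
  "poly_w = [:[:0, 1:]:]"

definition poly_v :: "'k::field poly3" where
  "poly_v = [:0, 1:]"

definition B_relator :: "'k::field poly3" where
  "B_relator = poly_u ^ 2 * poly_w - poly_v ^ 2 - poly_u"

definition B_cong :: "'k::field poly3 \<Rightarrow> 'k poly3 \<Rightarrow> bool" where
  "B_cong p q \<longleftrightarrow> B_relator dvd p - q"

lemma B_cong_equivp: "equivp (B_cong :: 'k::field poly3 \<Rightarrow> _)"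
proof (rule equivpI)
  show "reflp (B_cong :: 'k poly3 \<Rightarrow> _)"
    by (simp add: reflp_def B_cong_def)
  show "symp (B_cong :: 'k poly3 \<Rightarrow> _)"
    unfolding symp_def B_cong_def by (metis dvd_minus_iff minus_diff_eq)
  show "transp (B_cong :: 'k poly3 \<Rightarrow> _)"
    unfolding transp_def B_cong_def
  proof (intro allI impI)
    fix p q r :: "'k poly3"
    assume "B_relator dvd p - q" "B_relator dvd q - r"
    then have "B_relator dvd (p - q) + (q - r)"
      by (rule dvd_add)
    then show "B_relator dvd p - r"
      by simp
  qed
qed

quotient_type (overloaded) 'k B = "'k::field poly3" / B_cong
  by (rule B_cong_equivp)

lemma B_relator_not_unit: "\<not> (B_relator :: 'k::field poly3) dvd 1"
proof
  assume "(B_relator :: 'k poly3) dvd 1"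
  then obtain q :: "'k poly3" where q: "1 = B_relator * q" ..
  have "poly (poly (poly (1 :: 'k poly3) 0) 0) 0 = 0"
    unfolding q by (simp add: B_relator_def poly_u_def poly_v_def poly_w_def)
  then show False
    by simp
qed

instantiation B :: (field) comm_ring_1
begin

lift_definition zero_B :: "'a B" is 0 .

lift_definition one_B :: "'a B" is 1 .

lift_definition plus_B :: "'a B \<Rightarrow> 'a B \<Rightarrow> 'a B" is "(+)"
  unfolding B_cong_def by (metis add_diff_add dvd_add)

lift_definition uminus_B :: "'a B \<Rightarrow> 'a B" is uminus
  unfolding B_cong_def by (metis dvd_minus_iff minus_diff_eq minus_diff_minus)

lift_definition minus_B :: "'a B \<Rightarrow> 'a B \<Rightarrow> 'a B" is "(-)"
proof -
  fix a b c d :: "'a poly3"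
  assume "B_cong a b" "B_cong c d"
  moreover have "(a - c) - (b - d) = (a - b) - (c - d)"
    by simp
  ultimately show "B_cong (a - c) (b - d)"
    unfolding B_cong_def by (metis dvd_diff)
qed

lift_definition times_B :: "'a B \<Rightarrow> 'a B \<Rightarrow> 'a B" is "(*)"
proof -
  fix a b c d :: "'a poly3"
  assume "B_cong a b" "B_cong c d"
  moreover have "a * c - b * d = a * (c - d) + (a - b) * d"
    by (simp add: algebra_simps)
  ultimately show "B_cong (a * c) (b * d)"
    unfolding B_cong_def by (metis dvd_add dvd_mult dvd_mult2)
qed

instance
proof
  show "(0 :: 'a B) \<noteq> 1"
    by transfer (use B_relator_not_unit in \<open>simp add: B_cong_def\<close>)
qed (transfer; simp add: B_cong_def algebra_simps)+

end

definition B_of_poly :: "'k::field poly3 \<Rightarrow> 'k B" where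
  "B_of_poly = abs_B"

lemma B_of_poly_eq_iff: "B_of_poly p = B_of_poly q \<longleftrightarrow> B_relator dvd p - q"
  by (simp add: B_of_poly_def B.abs_eq_iff B_cong_def)

lemma surj_B_of_poly: "surj (B_of_poly :: 'k::field poly3 \<Rightarrow> _)"
proof (rule surjI)
  show "B_of_poly (rep_B x) = x" for x :: "'k B"
    unfolding B_of_poly_def by (rule Quotient_abs_rep[OF Quotient_B])
qed

lemma B_of_poly_hom:
  "B_of_poly 0 = 0"
  "B_of_poly 1 = 1"
  "B_of_poly (p + q) = B_of_poly p + B_of_poly q"
  "B_of_poly (p - q) = B_of_poly p - B_of_poly q"
  "B_of_poly (- p) = - B_of_poly p"
  "B_of_poly (p * q) = B_of_poly p * B_of_poly q"
  by (simp_all add: B_of_poly_def zero_B.abs_eq one_B.abs_eq plus_B.abs_eq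
      minus_B.abs_eq uminus_B.abs_eq times_B.abs_eq)

definition scaleB :: "'k::field \<Rightarrow> 'k B \<Rightarrow> 'k B" where
  "scaleB c a = B_of_poly (const3 c) * a"

definition u_B :: "'k::field B" where
  "u_B = B_of_poly poly_u"

definition v_B :: "'k::field B" where
  "v_B = B_of_poly poly_v"

definition w_B :: "'k::field B" where
  "w_B = B_of_poly poly_w"

lemma vector_space_scaleB: "vector_space (scaleB :: 'k::field \<Rightarrow> _)"
proof -
  have "const3 (a + b) = const3 a + const3 b" "const3 (a * b) = const3 a * const3 b"
    "const3 (1 :: 'k) = 1" for a b :: 'k
    by (simp_all add: const3_def one_pCons)
  then show ?thesis
    by unfold_locales (simp_all add: scaleB_def B_of_poly_hom algebra_simps)
qed

text \<open>
  For a commutative k-algebra with scalar multiplication s, a k-derivation is a k-linear map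
  satisfying the Leibniz rule.
\<close>

definition Der :: "('k::field \<Rightarrow> 'a::comm_ring_1 \<Rightarrow> 'a) \<Rightarrow> ('a \<Rightarrow> 'a) set" where
  "Der s = {D. Vector_Spaces.linear s s D \<and> (\<forall>a b. D (a * b) = D a * b + a * D b)}"

definition is_ideal :: "'a::comm_ring_1 set \<Rightarrow> bool" where
  "is_ideal I \<longleftrightarrow> 0 \<in> I \<and> (\<forall>a\<in>I. \<forall>b\<in>I. a + b \<in> I) \<and> (\<forall>r. \<forall>a\<in>I. r * a \<in> I)"

definition simple_derivation :: "('a::comm_ring_1 \<Rightarrow> 'a) \<Rightarrow> bool" where
  "simple_derivation D \<longleftrightarrow> (\<forall>I. is_ideal I \<and> D ` I \<subseteq> I \<longrightarrow> I = {0} \<or> I = UNIV)"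

definition is_calD :: "('k::field B \<Rightarrow> 'k B) \<Rightarrow> bool" where
  "is_calD D \<longleftrightarrow> D \<in> Der scaleB \<and>
     D w_B = 1 \<and>
     D u_B = v_B + u_B ^ 2 * w_B - u_B - u_B ^ 2 \<and>
     D v_B = u_B * v_B * w_B - u_B * v_B + u_B * w_B - scaleB (1 / 2) (v_B + 1)"

end

theory Submission
  imports Defs
begin

text \<open>
  The surface is a family of conics over the line with coordinate w, and D is a Riccati equation in
  disguise. Where u is invertible, put t = v / u; the relation becomes 1 / u = w - t^2, and
  with x = t - 1/2 and z = w + 1/4 the derivation becomes D(w) = 1, 2 D(x) = z - x^2.
  Setting x = 2 y' / y turns this into the Airy equation 4 y'' = z y. Simplicity says that the
  Riccati equation has no algebraic solution over k(w), and that no ideal supported on the curve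
  u = 0 is stable.

  First, the polynomial ring k[w][x] with the derivation \<open>\<Delta> = 2 \<partial>\<^sub>w + (z - x\<^sup>2) \<partial>\<^sub>x\<close> is simple
  (\<open>riccati_derivation_simple\<close>). In a nonzero stable ideal pick f of least degree n in x and, among
  those, with leading coefficient of least degree in w. Then \<open>\<Delta> f + n x f\<close> has degree at most n again,
  so it equals h f for some h in k[w]. Comparing coefficients yields a three-term recursion for the
  coefficients of f, starting from the leading one and required to stop after n steps.
  The growth of these coefficients as polynomials in w shows that the recursion stops
  only if n = 0 and f is constant (\<open>terminates_imp_trivial\<close>). This replaces the usual analysis of
  the Puiseux expansions of an algebraic solution.

  Second, this is carried over to the surface without localising. With y = u x = v - u / 2, a polynomial
  p in k[w][x] of degree at most N has the homogenisation u^N p(y / u) in B. For a stable ideal I of B,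
  the p having some homogenisation in I form an ideal J, and J is stable under \<open>\<Delta>\<close>
  (\<open>calD_homogenise\<close>). Hence J = 0 or J contains 1.

  If J = 0, then I = 0: every element of B times a power of u is a homogenisation
  (\<open>homogeneous_repr_exists\<close>), and u is not a zero divisor. If J contains 1, then I contains a power of u.
  The radical of I is stable as well; it contains u, hence v because v^2 = u (u w - 1), hence D(v),
  which is -1/2 modulo (u, v). So I = B.

  Existence of D holds because the corresponding derivation of k[u,v,w] maps the relation to a multiple
  of itself; uniqueness holds because u, v and w generate B.
\<close>

section \<open>Derivations, ideals and radicals\<close>

definition is_derivation :: "('a::comm_ring_1 \<Rightarrow> 'a) \<Rightarrow> bool" where
  "is_derivation d \<longleftrightarrow> (\<forall>a b. d (a + b) = d a + d b) \<and> (\<forall>a b. d (a * b) = d a * b + a * d b)"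

lemma is_derivation_plus: "is_derivation d \<Longrightarrow> d (a + b) = d a + d b"
  by (simp add: is_derivation_def)

lemma is_derivation_mult: "is_derivation d \<Longrightarrow> d (a * b) = d a * b + a * d b"
  by (simp add: is_derivation_def)

lemma is_derivation_zero: "is_derivation d \<Longrightarrow> d 0 = 0"
  unfolding is_derivation_def by (metis add_cancel_right_right)

lemma is_derivation_one: "is_derivation d \<Longrightarrow> d 1 = 0"
  unfolding is_derivation_def by (metis add_cancel_right_right mult_1 mult_1_right)

lemma is_derivation_minus: "is_derivation d \<Longrightarrow> d (- a) = - d a"
  using is_derivation_zero[of d] unfolding is_derivation_def
  by (metis add.right_inverse add_eq_0_iff)

lemma is_derivation_diff: "is_derivation d \<Longrightarrow> d (a - b) = d a - d b"
  using is_derivation_minus[of d b] unfolding is_derivation_def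
  by (metis diff_conv_add_uminus)

lemma is_derivation_sum: "is_derivation d \<Longrightarrow> d (sum f A) = (\<Sum>x\<in>A. d (f x))"
  by (induction A rule: infinite_finite_induct) (simp_all add: is_derivation_zero, simp add: is_derivation_def)

lemma is_derivation_power: "is_derivation d \<Longrightarrow> d (a ^ n) = of_nat n * a ^ (n - 1) * d a"
proof (induction n)
  case 0
  then show ?case by (simp add: is_derivation_one)
next
  case (Suc n)
  then have "d (a ^ Suc n) = d a * a ^ n + a * d (a ^ n)"
    by (simp add: is_derivation_def)
  also have "\<dots> = of_nat (Suc n) * a ^ n * d a"
    using Suc by (cases n) (simp_all add: algebra_simps)
  finally show ?case by simp
qed

lemma is_derivation_pderiv: "is_derivation (pderiv :: 'a::idom poly \<Rightarrow> _)"
  by (simp add: is_derivation_def pderiv_add pderiv_mult)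

lemma is_derivation_map_poly:
  assumes d: "is_derivation d"
  shows "is_derivation (map_poly d)"
proof -
  note z = is_derivation_zero[OF d]
  have "map_poly d (p * q) = map_poly d p * q + p * map_poly d q" for p q
  proof (rule poly_eqI)
    fix n
    have "d (\<Sum>i\<le>n. coeff p i * coeff q (n - i)) =
        (\<Sum>i\<le>n. d (coeff p i) * coeff q (n - i) + coeff p i * d (coeff q (n - i)))"
      using d by (simp add: is_derivation_sum) (simp add: is_derivation_def)
    then show "coeff (map_poly d (p * q)) n = coeff (map_poly d p * q + p * map_poly d q) n"
      by (simp add: coeff_map_poly z coeff_mult sum.distrib)
  qed
  moreover have "map_poly d (p + q) = map_poly d p + map_poly d q" for p q
    using d by (intro poly_eqI) (simp add: coeff_map_poly z, simp add: is_derivation_def)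
  ultimately show ?thesis by (simp add: is_derivation_def)
qed

lemma is_derivation_add:
  "is_derivation d \<Longrightarrow> is_derivation e \<Longrightarrow> is_derivation (\<lambda>p. d p + e p)"
  by (simp add: is_derivation_def algebra_simps)

lemma is_derivation_scale: "is_derivation d \<Longrightarrow> is_derivation (\<lambda>p. a * d p)"
  by (simp add: is_derivation_def algebra_simps)

lemma is_ideal_mult: "is_ideal I \<Longrightarrow> a \<in> I \<Longrightarrow> r * a \<in> I"
  by (simp add: is_ideal_def)

lemma is_ideal_add: "is_ideal I \<Longrightarrow> a \<in> I \<Longrightarrow> b \<in> I \<Longrightarrow> a + b \<in> I"
  by (simp add: is_ideal_def)

lemma is_ideal_diff: "is_ideal I \<Longrightarrow> a \<in> I \<Longrightarrow> b \<in> I \<Longrightarrow> a - b \<in> I"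
  using is_ideal_mult[of I b "-1"] is_ideal_add[of I a "-b"] by simp

lemma ideal_power_mono:
  assumes "is_ideal I" "a ^ n \<in> I" "n \<le> k"
  shows "a ^ k \<in> I"
  using is_ideal_mult[OF assms(1,2), of "a ^ (k - n)"] assms(3)
  by (simp flip: power_add)

definition radical_of :: "'a::comm_ring_1 set \<Rightarrow> 'a set" where
  "radical_of I = {a. \<exists>n. a ^ n \<in> I}"

lemma is_ideal_sum:
  assumes "is_ideal I" "\<And>x. x \<in> A \<Longrightarrow> f x \<in> I"
  shows "sum f A \<in> I"
  using assms(2) by (induction A rule: infinite_finite_induct)
    (use assms(1) in \<open>auto simp: is_ideal_def\<close>)

lemma is_ideal_radical:
  assumes I: "is_ideal I"
  shows "is_ideal (radical_of I)"
proof -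
  have "a + b \<in> radical_of I" if ab: "a \<in> radical_of I" "b \<in> radical_of I" for a b
  proof -
    obtain n k where n: "a ^ n \<in> I" and k: "b ^ k \<in> I"
      using ab by (auto simp: radical_of_def)
    have "of_nat (n + k choose i) * a ^ i * b ^ (n + k - i) \<in> I" for i
    proof (cases "n \<le> i")
      case True
      then show ?thesis
        using is_ideal_mult[OF I ideal_power_mono[OF I n True], of "of_nat (n + k choose i) * b ^ (n + k - i)"]
        by (simp add: mult_ac)
    next
      case False
      then have "b ^ (n + k - i) \<in> I" by (intro ideal_power_mono[OF I k]) simp
      then show ?thesis by (rule is_ideal_mult[OF I])
    qed
    then have "(a + b) ^ (n + k) \<in> I"
      unfolding binomial_ring by (intro is_ideal_sum[OF I])
    then show ?thesis by (auto simp: radical_of_def)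
  qed
  moreover have "r * a \<in> radical_of I" if "a \<in> radical_of I" for r a
    using that is_ideal_mult[OF I] by (auto simp: radical_of_def power_mult_distrib)
  moreover have "0 \<in> radical_of I"
    using I by (auto simp: radical_of_def is_ideal_def intro!: exI[of _ 1])
  ultimately show ?thesis by (simp add: is_ideal_def)
qed

text \<open>
  Starting from a^n, apply d to a^(n-j) (d a)^(2j) and multiply by d a. One summand is an integer multiple of
  the same expression for j + 1, the other lies in the ideal. After n steps only (d a)^(2n) is left.
\<close>

lemma derivation_maps_radical:
  fixes d :: "'a::comm_ring_1 \<Rightarrow> 'a"
  assumes I: "is_ideal I" and d: "is_derivation d" and stable: "d ` I \<subseteq> I"
    and inv: "\<And>n. n > 0 \<Longrightarrow> \<exists>r::'a. r * of_nat n = 1"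
    and a: "a \<in> radical_of I"
  shows "d a \<in> radical_of I"
proof -
  obtain n where n: "a ^ n \<in> I" using a by (auto simp: radical_of_def)
  have "j \<le> n \<Longrightarrow> a ^ (n - j) * (d a) ^ (2 * j) \<in> I" for j
  proof (induction j)
    case 0
    then show ?case using n by simp
  next
    case (Suc j)
    obtain l where l: "n - j = Suc l" "n - Suc j = l"
      using Suc.prems by (metis Suc_diff_Suc Suc_le_eq)
    let ?x = "a ^ Suc l * (d a) ^ (2 * j)"
    have x: "?x \<in> I" using Suc l by simp
    obtain r :: 'a where r: "r * of_nat (Suc l) = 1" using inv[of "Suc l"] by auto
    have "d ?x = of_nat (Suc l) * a ^ l * d a * (d a) ^ (2 * j)
        + a ^ Suc l * (of_nat (2 * j) * (d a) ^ (2 * j - 1) * d (d a))"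
      unfolding is_derivation_mult[OF d, of "a ^ Suc l"] is_derivation_power[OF d] by simp
    then have "d a * d ?x = of_nat (Suc l) * (a ^ l * (d a) ^ (2 * Suc j))
        + of_nat (2 * j) * d (d a) * ?x"
      by (cases j) (simp_all add: algebra_simps)
    then have eq: "r * (d a * d ?x - of_nat (2 * j) * d (d a) * ?x)
        = (r * of_nat (Suc l)) * (a ^ l * (d a) ^ (2 * Suc j))"
      by (simp only: add_diff_cancel_right' mult.assoc)
    have "d ?x \<in> I"
      using x stable by blast
    then have "r * (d a * d ?x - of_nat (2 * j) * d (d a) * ?x) \<in> I"
      by (intro is_ideal_mult[OF I, of _ r] is_ideal_diff[OF I] is_ideal_mult[OF I, of "d ?x"]
          is_ideal_mult[OF I x])
    then show ?case
      unfolding eq r l(2) by simp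
  qed
  from this[of n] show ?thesis by (auto simp: radical_of_def)
qed

section \<open>The recursion behind the Riccati equation\<close>

lemma coeff_shifted_linear_mult:
  fixes p :: "'k::comm_ring_1 poly"
  shows "coeff ([:c, 1:] * p) k = c * coeff p k + (case k of 0 \<Rightarrow> 0 | Suc l \<Rightarrow> coeff p l)"
  by (simp add: coeff_pCons split: nat.splits)

lemma degree_shifted_linear_mult_le:
  fixes p :: "'k::comm_ring_1 poly"
  shows "degree ([:c, 1:] * p) \<le> Suc (degree p)"
  using degree_mult_le[of "[:c, 1:]" p] by simp

text \<open>
  If f has degree n in x and \<open>\<Delta> f + n x f = h f\<close>, then g j = j! times the coefficient of x^(n-j) in f
  satisfies this recursion. The factor j! clears the denominators, so that all the constants that
  occur are natural numbers.
\<close>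

locale riccati_recursion =
  fixes g :: "nat \<Rightarrow> 'k::field_char_0 poly" and h :: "'k poly" and c :: 'k and n :: nat
  assumes start: "g 1 = h * g 0 - smult 2 (pderiv (g 0))"
    and step: "\<And>j. j < n \<Longrightarrow> g (j + 2) = h * g (j + 1) - smult 2 (pderiv (g (j + 1)))
                 - smult (of_nat ((j + 1) * (n - j))) ([:c, 1:] * g j)"
    and nonzero: "g 0 \<noteq> 0"
begin

abbreviation "m \<equiv> degree (g 0)"
abbreviation "a \<equiv> lead_coeff (g 0)"

text \<open>
  When h has positive degree, the term h * g (j + 1) outgrows the other two at each step, so the
  recursion behaves like g j = h^j * g 0 and never reaches 0.
\<close>

lemma last_nonzero_if_h_nonconstant:
  assumes h: "degree h > 0"
  shows "g (n + 1) \<noteq> 0"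
proof -
  have perturb: "h * p - q \<noteq> 0 \<and> degree (h * p - q) = degree h + degree p"
    if "p \<noteq> 0" "degree q < degree h + degree p" for p q :: "'k poly"
  proof -
    have "degree (h * p) = degree h + degree p"
      using that h by (intro degree_mult_eq) auto
    moreover from this have "degree (h * p + - q) = degree (h * p)"
      using that by (intro degree_add_eq_left) simp
    ultimately show ?thesis
      using h by (metis add_gr_0 degree_0 diff_conv_add_uminus less_numeral_extra(3))
  qed
  have "j \<le> n \<Longrightarrow> g j \<noteq> 0 \<and> degree (g j) = m + j * degree h
     \<and> g (j + 1) \<noteq> 0 \<and> degree (g (j + 1)) = m + (j + 1) * degree h" for j
  proof (induction j)
    case 0
    have "degree (smult 2 (pderiv (g 0))) < degree h + m"
      using h by (simp add: degree_pderiv)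
    from perturb[OF nonzero this] show ?case
      using nonzero start by simp
  next
    case (Suc j)
    then have IH: "g j \<noteq> 0" "degree (g j) = m + j * degree h"
      "g (j + 1) \<noteq> 0" "degree (g (j + 1)) = m + (j + 1) * degree h"
      by auto
    let ?q = "smult 2 (pderiv (g (j + 1)))
                 + smult (of_nat ((j + 1) * (n - j))) ([:c, 1:] * g j)"
    have "degree (smult (of_nat ((j + 1) * (n - j))) ([:c, 1:] * g j)) \<le> Suc (degree (g j))"
      by (rule order.trans[OF degree_smult_le degree_shifted_linear_mult_le])
    moreover have "degree (smult 2 (pderiv (g (j + 1)))) \<le> degree (g (j + 1))"
      by (simp add: degree_pderiv)
    moreover have "Suc (degree (g j)) \<le> degree (g (j + 1))"
      using IH h by simp
    ultimately have "degree ?q \<le> degree (g (j + 1))"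
      by (intro degree_add_le) linarith+
    then have "degree ?q < degree h + degree (g (j + 1))"
      using h by linarith
    from perturb[OF IH(3) this] have "g (j + 2) \<noteq> 0 \<and> degree (g (j + 2)) = degree h + degree (g (j + 1))"
      using step[of j] Suc.prems by (simp add: diff_diff_eq)
    then show ?case
      using IH by simp
  qed
  from this[of n] show ?thesis by simp
qed

text \<open>
  For constant h the dominant term is the one with z, which links indices of equal parity.
  Each two steps raise the degree by one and flip the sign, while the remaining factor is a positive
  integer. This is the expansion at infinity of (x^2 - z)^(n/2). An odd index inherits its leading
  term from the even one below it, with an additional factor h = \<open>\<gamma>\<close>. Positivity of e is what
  excludes cancellation.
\<close>

definition even_growth :: "nat \<Rightarrow> bool" where
  "even_growth i \<longleftrightarrow> degree (g (2 * i)) \<le> m + i \<and>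
     (\<exists>e. e > 0 \<and> coeff (g (2 * i)) (m + i) = (- 1) ^ i * of_nat e * a)"

definition odd_growth :: "'k \<Rightarrow> nat \<Rightarrow> bool" where
  "odd_growth \<gamma> i \<longleftrightarrow> degree (g (2 * i + 1)) \<le> m + i \<and>
     (\<exists>e. e > 0 \<and> coeff (g (2 * i + 1)) (m + i) = (- 1) ^ i * of_nat e * \<gamma> * a)"

lemma even_growth_Suc:
  assumes h: "h = [:\<gamma>:]" and i: "2 * i < n"
    and even: "even_growth i" and odd: "degree (g (2 * i + 1)) \<le> m + i"
  shows "even_growth (Suc i)"
proof -
  obtain e where e: "e > 0" "coeff (g (2 * i)) (m + i) = (- 1) ^ i * of_nat e * a"
    and deg: "degree (g (2 * i)) \<le> m + i"
    using even by (auto simp: even_growth_def)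
  define k where "k = (2 * i + 1) * (n - 2 * i)"
  define p where "p = g (2 * i)"
  define q where "q = g (2 * i + 1)"
  have eq: "g (2 * Suc i) = smult \<gamma> q - smult 2 (pderiv q) - smult (of_nat k) ([:c, 1:] * p)"
    using step[OF i] h by (simp add: k_def p_def q_def)
  have z1: "coeff q l = 0" if "l > m + i" for l
    using odd that unfolding q_def by (intro coeff_eq_0) simp
  have z0: "coeff p l = 0" if "l > m + i" for l
    using deg that unfolding p_def by (intro coeff_eq_0) simp
  have "coeff (g (2 * Suc i)) l = 0" if "l > m + Suc i" for l
    unfolding eq using that
    by (auto simp: coeff_shifted_linear_mult coeff_pderiv z1 z0 simp del: mult_pCons_left split: nat.splits)
  then have "degree (g (2 * Suc i)) \<le> m + Suc i"
    by (intro degree_le) blast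
  moreover have "coeff (g (2 * Suc i)) (m + Suc i) = (- 1) ^ Suc i * of_nat (k * e) * a"
    unfolding eq using e(2)[folded p_def]
    by (simp add: coeff_shifted_linear_mult coeff_pderiv z1 z0 algebra_simps del: mult_pCons_left)
  moreover have "k * e > 0"
    using e(1) i by (simp add: k_def)
  ultimately show ?thesis
    unfolding even_growth_def by blast
qed

lemma odd_growth_Suc:
  assumes h: "h = [:\<gamma>:]" and i: "2 * Suc i \<le> n"
    and even: "even_growth (Suc i)" and odd: "odd_growth \<gamma> i"
  shows "odd_growth \<gamma> (Suc i)"
proof -
  obtain e where e: "e > 0" "coeff (g (2 * Suc i)) (m + Suc i) = (- 1) ^ Suc i * of_nat e * a"
    and deg: "degree (g (2 * Suc i)) \<le> m + Suc i"
    using even by (auto simp: even_growth_def)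
  obtain e' where e': "coeff (g (2 * i + 1)) (m + i) = (- 1) ^ i * of_nat e' * \<gamma> * a"
    and deg': "degree (g (2 * i + 1)) \<le> m + i"
    using odd by (auto simp: odd_growth_def)
  define k where "k = (2 * i + 2) * (n - (2 * i + 1))"
  define p where "p = g (2 * Suc i)"
  define q where "q = g (2 * i + 1)"
  have eq: "g (2 * Suc i + 1) = smult \<gamma> p - smult 2 (pderiv p)
       - smult (of_nat k) ([:c, 1:] * q)"
    using step[of "2 * i + 1"] i h by (simp add: k_def p_def q_def)
  have z1: "coeff q l = 0" if "l > m + i" for l
    using deg' that unfolding q_def by (intro coeff_eq_0) simp
  have z0: "coeff p l = 0" if "l > m + Suc i" for l
    using deg that unfolding p_def by (intro coeff_eq_0) simp
  have "coeff (g (2 * Suc i + 1)) l = 0" if "l > m + Suc i" for l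
    unfolding eq using that
    by (auto simp: coeff_shifted_linear_mult coeff_pderiv z1 z0 simp del: mult_pCons_left mult_Suc_right split: nat.splits)
  then have "degree (g (2 * Suc i + 1)) \<le> m + Suc i"
    by (intro degree_le) blast
  moreover have "coeff (g (2 * Suc i + 1)) (m + Suc i) = (- 1) ^ Suc i * of_nat (e + k * e') * \<gamma> * a"
    unfolding eq using e(2)[folded p_def] e'[folded q_def]
    by (simp add: coeff_shifted_linear_mult coeff_pderiv z1 z0 algebra_simps del: mult_pCons_left)
  moreover have "e + k * e' > 0"
    using e(1) by simp
  ultimately show ?thesis
    unfolding odd_growth_def by blast
qed

lemma growth:
  assumes h: "h = [:\<gamma>:]"
  shows "2 * i \<le> n \<Longrightarrow> even_growth i \<and> odd_growth \<gamma> i"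
proof (induction i)
  case 0
  have "degree (g 1) \<le> m"
    unfolding start h by (intro degree_diff_le) (simp_all add: degree_pderiv)
  moreover have "coeff (g 1) m = of_nat 1 * \<gamma> * a"
    unfolding start h by (simp add: coeff_pderiv coeff_eq_0)
  ultimately have "odd_growth \<gamma> 0"
    unfolding odd_growth_def by (auto intro!: exI[of _ "1::nat"])
  moreover have "even_growth 0"
    unfolding even_growth_def by (auto intro!: exI[of _ "1::nat"])
  ultimately show ?case by blast
next
  case (Suc i)
  then have "even_growth i" "odd_growth \<gamma> i" by auto
  then have "even_growth (Suc i)"
    using even_growth_Suc[OF h] Suc.prems by (auto simp: odd_growth_def)
  with odd_growth_Suc[OF h] Suc.prems \<open>odd_growth \<gamma> i\<close> show ?case by blast
qed

text \<open>
  For h = 0 the odd terms drop by one more degree, and the contribution of the derivatives becomes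
  visible. All contributions have the same sign, so again nothing cancels.
\<close>

lemma odd_growth_second_order:
  assumes h: "h = 0"
  shows "2 * i \<le> n \<Longrightarrow> k + 1 = m + i \<Longrightarrow>
    \<exists>e. e > 0 \<and> coeff (g (2 * i + 1)) k = - ((- 1) ^ i * of_nat e * a)"
proof (induction i arbitrary: k)
  case 0
  have "coeff (g 1) k = - (of_nat (2 * m) * a)"
    using 0 unfolding start h by (simp add: coeff_pderiv)
  moreover have "2 * m > 0" using 0 by simp
  ultimately show ?case by (intro exI[of _ "2 * m"]) simp
next
  case (Suc i)
  have h': "h = [:0:]" using h by simp
  obtain e where e: "e > 0" "coeff (g (2 * Suc i)) (m + Suc i) = (- 1) ^ Suc i * of_nat e * a"
    using growth[OF h', of "Suc i"] Suc.prems by (auto simp: even_growth_def)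
  have top: "coeff (g (2 * i + 1)) (m + i) = 0"
    using growth[OF h', of i] Suc.prems by (auto simp: odd_growth_def)
  define K where "K = (2 * i + 2) * (n - (2 * i + 1))"
  define p where "p = g (2 * Suc i)"
  define q where "q = g (2 * i + 1)"
  have eq: "g (2 * Suc i + 1) = - smult 2 (pderiv p) - smult (of_nat K) ([:c, 1:] * q)"
    using step[of "2 * i + 1"] Suc.prems h by (simp add: K_def p_def q_def)
  have k: "k = m + i" using Suc.prems by simp
  obtain e' where e': "(case m + i of 0 \<Rightarrow> 0 | Suc l \<Rightarrow> coeff (g (2 * i + 1)) l)
      = - ((- 1) ^ i * of_nat e' * a)"
  proof (cases "m + i")
    case 0
    then show ?thesis using that[of 0] by simp
  next
    case (Suc l)
    then show ?thesis using that Suc.IH[of l] Suc.prems by auto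
  qed
  have "coeff (g (2 * Suc i + 1)) k
     = - ((- 1) ^ Suc i * of_nat (2 * (k + 1) * e + K * e') * a)"
  proof -
    have "coeff p (Suc k) = (- 1) ^ Suc i * of_nat e * a"
      using e(2) k by (simp add: p_def)
    moreover have "coeff ([:c, 1:] * q) k = - ((- 1) ^ i * of_nat e' * a)"
      unfolding coeff_shifted_linear_mult k using e'[folded q_def] top[folded q_def] by simp
    ultimately show ?thesis
      unfolding eq by (simp add: coeff_pderiv algebra_simps del: mult_pCons_left)
  qed
  moreover have "2 * (k + 1) * e + K * e' > 0"
    using e(1) by simp
  ultimately show ?case by blast
qed

text \<open>
  For odd n the term with index n + 1 is even-indexed and has a nonzero leading coefficient. For even n it is
  odd-indexed: its first-order coefficient forces h = 0, and then its second-order coefficient is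
  nonzero unless there is no room for it, that is, unless m + n / 2 = 0.
\<close>

lemma terminates_imp_trivial:
  assumes last: "g (n + 1) = 0"
  shows "n = 0 \<and> degree (g 0) = 0"
proof -
  obtain \<gamma> where h: "h = [:\<gamma>:]"
    using last_nonzero_if_h_nonconstant last degree_eq_zeroE by blast
  have a: "a \<noteq> 0" using nonzero by simp
  have "even n"
  proof (rule ccontr)
    assume "odd n"
    then obtain i where i: "n = 2 * i + 1" by (elim oddE)
    then have "even_growth (Suc i)"
      using growth[OF h, of i] by (intro even_growth_Suc[OF h]) (auto simp: odd_growth_def)
    then show False
      using last i a by (auto simp: even_growth_def)
  qed
  then obtain N where N: "n = 2 * N" by (elim evenE)
  have "odd_growth \<gamma> N"
    using growth[OF h] N by simp
  then have "\<gamma> = 0"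
    using last N a by (auto simp: odd_growth_def)
  then have h0: "h = 0" using h by simp
  have "m + N = 0"
  proof (rule ccontr)
    assume "m + N \<noteq> 0"
    then obtain k where "k + 1 = m + N" by (metis Suc_eq_plus1 not0_implies_Suc)
    from odd_growth_second_order[OF h0 _ this] show False
      using last N a by auto
  qed
  then show ?thesis using N by simp
qed

end

section \<open>Simplicity of the Riccati derivation on the plane\<close>

text \<open>
  With outer variable x, inner variable w and z = w + 1/4, this is twice the derivation given by
  w' = 1 and x' = (z - x^2) / 2.
\<close>

definition riccati_derivation :: "'k::field_char_0 poly poly \<Rightarrow> 'k poly poly" where
  "riccati_derivation p = smult 2 (map_poly pderiv p) + [:[:1/4, 1:], 0, -1:] * pderiv p"

text \<open>
  Adding n x f cancels the coefficient of x^(n+1) that the term -x^2 creates for f of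
  degree n.
\<close>

lemma coeff_riccati_derivation_add:
  fixes f :: "'k::field_char_0 poly poly"
  shows "coeff (riccati_derivation f + of_nat n * ([:0, 1:] * f)) i =
    smult 2 (pderiv (coeff f i)) + smult (of_nat (Suc i)) ([:1/4, 1:] * coeff f (Suc i))
      + (case i of 0 \<Rightarrow> 0 | Suc l \<Rightarrow> smult (of_nat n - of_nat l) (coeff f l))"
proof -
  have s: "smult (of_nat k) q = of_nat k * q" for k and q :: "'k poly"
    by (simp add: of_nat_poly)
  have s2: "smult 2 q = 2 * q" for q :: "'k poly"
    by (simp add: numeral_poly)
  have n: "coeff (of_nat n * ([:0, 1:] * f)) i = (case i of 0 \<Rightarrow> 0 | Suc l \<Rightarrow> of_nat n * coeff f l)"
    by (simp add: of_nat_poly coeff_pCons split: nat.splits)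
  have d: "coeff (riccati_derivation f) i = 2 * pderiv (coeff f i) + of_nat (Suc i) * ([:1/4, 1:] * coeff f (Suc i))
       - (case i of 0 \<Rightarrow> 0 | Suc l \<Rightarrow> of_nat l * coeff f l)"
  proof -
    have "coeff ([:z, 0, -1:] * p) i =
        z * coeff p i - (case i of 0 \<Rightarrow> 0 | Suc l \<Rightarrow> (case l of 0 \<Rightarrow> 0 | Suc k \<Rightarrow> coeff p k))"
      for z :: "'k poly" and p
      by (simp add: coeff_pCons split: nat.splits)
    then show ?thesis
      unfolding riccati_derivation_def coeff_add coeff_smult s2 coeff_pderiv
      by (simp add: coeff_map_poly coeff_pderiv mult.left_commute del: mult_pCons_left mult_pCons_right of_nat_Suc split: nat.splits)
  qed
  show ?thesis
    unfolding coeff_add n d by (cases i) (simp_all add: s s2 smult_diff_left algebra_simps del: mult_pCons_left mult_pCons_right of_nat_Suc)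
qed

text \<open>
  Take f of least degree in the outer variable and, among those, with leading coefficient of least
  degree in the inner variable w. Dividing leading coefficients by that of f with remainder shows that
  the elements of J of no larger degree are multiples of f by elements of k[w]. That the factor is a
  polynomial and not a fraction is what makes degree arguments in w possible later.
\<close>

lemma ideal_obtains_minimal_element:
  fixes J :: "'k::field poly poly set"
  assumes J: "is_ideal J" and nz: "J \<noteq> {0}"
  obtains f where "f \<in> J" "f \<noteq> 0"
    and "\<And>p. p \<in> J \<Longrightarrow> degree p \<le> degree f \<Longrightarrow> \<exists>h. p = smult h f"
proof -
  obtain f0 where "f0 \<in> J \<and> f0 \<noteq> 0"
    using J nz by (auto simp: is_ideal_def)
  then obtain f where f: "f \<in> J \<and> f \<noteq> 0"
    and min: "\<And>p. (p, f) \<in> measures [degree, \<lambda>p. degree (lead_coeff p)] \<Longrightarrow> \<not> (p \<in> J \<and> p \<noteq> 0)"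
    using wf_measures[THEN wfE_min, of f0 "{p. p \<in> J \<and> p \<noteq> 0}" "[degree, \<lambda>p. degree (lead_coeff p)]"]
    by auto
  show thesis
  proof (rule that)
    fix p assume p: "p \<in> J" "degree p \<le> degree f"
    let ?n = "degree f" and ?a = "lead_coeff f"
    define q where "q = coeff p ?n div ?a"
    define r where "r = p - smult q f"
    have "smult q f \<in> J"
      using is_ideal_mult[OF J, of f "[:q:]"] f by simp
    then have "r \<in> J"
      unfolding r_def using p J by (simp add: is_ideal_diff)
    have deg: "degree r \<le> ?n"
      unfolding r_def using p by (intro degree_diff_le) (simp_all add: degree_smult_le)
    have top: "coeff r ?n = coeff p ?n mod ?a"
      by (simp add: r_def q_def minus_div_mult_eq_mod)
    have "r = 0"
    proof (rule ccontr)
      assume "r \<noteq> 0"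
      then have notless: "(r, f) \<notin> measures [degree, \<lambda>p. degree (lead_coeff p)]"
        using min \<open>r \<in> J\<close> by blast
      then have "degree r = ?n"
        using deg by (auto simp: in_measures)
      then have "coeff r ?n \<noteq> 0"
        using \<open>r \<noteq> 0\<close> by (metis leading_coeff_0_iff)
      then have "degree (coeff r ?n) < degree ?a"
        using f degree_mod_less[of ?a "coeff p ?n"] top by auto
      then show False
        using notless \<open>degree r = ?n\<close> by (auto simp: in_measures)
    qed
    then show "\<exists>h. p = smult h f"
      unfolding r_def by (intro exI[of _ q]) simp
  qed (use f in auto)
qed

text \<open>
  A minimal element f satisfies \<open>\<Delta> f + n x f = h f\<close>, and its coefficients, read from the leading one downwards,
  obey the Riccati recursion. The recursion has to stop at n + 1 because f has no coefficient of index -1.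
  So f is a nonzero constant.
\<close>

lemma riccati_derivation_simple:
  fixes J :: "'k::field_char_0 poly poly set"
  assumes J: "is_ideal J" and nz: "J \<noteq> {0}" and stable: "riccati_derivation ` J \<subseteq> J"
  shows "1 \<in> J"
proof -
  obtain f where f: "f \<in> J" "f \<noteq> 0"
    and min: "\<And>p. p \<in> J \<Longrightarrow> degree p \<le> degree f \<Longrightarrow> \<exists>h. p = smult h f"
    using ideal_obtains_minimal_element[OF J nz] by blast
  define n where "n = degree f"
  let ?p = "riccati_derivation f + of_nat n * ([:0, 1:] * f)"
  have "?p \<in> J"
    using f stable J by (intro is_ideal_add is_ideal_mult) auto
  moreover have "degree ?p \<le> n"
  proof (intro degree_le allI impI)
    fix i assume "i > n"
    then obtain l where l: "i = Suc l" "l \<ge> n"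
      by (cases i) auto
    have "l = n \<or> coeff f l = 0"
      using l by (auto simp: n_def intro: coeff_eq_0)
    moreover have "coeff f i = 0" "coeff f (Suc i) = 0"
      using l by (auto simp: n_def intro: coeff_eq_0)
    ultimately show "coeff ?p i = 0"
      unfolding coeff_riccati_derivation_add using l by auto
  qed
  ultimately obtain h where h: "?p = smult h f"
    using min n_def by blast
  have rel: "(case i of 0 \<Rightarrow> 0 | Suc l \<Rightarrow> smult (of_nat n - of_nat l) (coeff f l)) =
      h * coeff f i - smult 2 (pderiv (coeff f i)) - smult (of_nat (Suc i)) ([:1/4, 1:] * coeff f (Suc i))" for i
    using coeff_riccati_derivation_add[of f n i] unfolding h by (simp add: algebra_simps)
  define g where "g = (\<lambda>j. if j \<le> n then smult (fact j) (coeff f (n - j)) else 0)"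
  have next_g: "g (Suc j) = smult (fact j) (case n - j of 0 \<Rightarrow> 0 | Suc l \<Rightarrow> smult (of_nat n - of_nat l) (coeff f l))"
    if "j \<le> n" for j
  proof (cases "j = n")
    case False
    define l where "l = n - Suc j"
    have l: "n - j = Suc l" "n = l + Suc j"
      using that False by (simp_all add: l_def)
    then show ?thesis
      unfolding g_def l by (simp add: algebra_simps)
  qed (simp add: g_def)
  interpret riccati_recursion g h "1/4" n
  proof
    show "g 1 = h * g 0 - smult 2 (pderiv (g 0))"
      using next_g[of 0] rel[of n] by (simp add: g_def n_def coeff_eq_0)
    show "g 0 \<noteq> 0"
      using f by (simp add: g_def n_def)
    fix j assume j: "j < n"
    then have s: "Suc (n - (j + 1)) = n - j" by simp
    have fct: "fact (j + 1) * of_nat (n - j) = (of_nat ((j + 1) * (n - j)) * fact j :: 'k)"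
      by (simp only: Suc_eq_plus1[symmetric] fact_Suc of_nat_mult mult_ac)
    have "g (j + 2) = smult (fact (j + 1)) (h * coeff f (n - (j + 1)) - smult 2 (pderiv (coeff f (n - (j + 1))))
             - smult (of_nat (n - j)) ([:1/4, 1:] * coeff f (n - j)))"
      using next_g[of "j + 1"] rel[of "n - (j + 1)"] j unfolding s by simp
    also have "\<dots> = h * g (j + 1) - smult 2 (pderiv (g (j + 1)))
             - smult (of_nat ((j + 1) * (n - j)) * fact j) ([:1/4, 1:] * coeff f (n - j))"
      using j unfolding smult_diff_right smult_smult fct by (simp add: g_def pderiv_smult mult.commute del: fact_Suc mult_pCons_left)
    also have "\<dots> = h * g (j + 1) - smult 2 (pderiv (g (j + 1)))
             - smult (of_nat ((j + 1) * (n - j))) ([:1/4, 1:] * g j)"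
      using j by (simp add: g_def del: mult_pCons_left)
    finally show "g (j + 2) = h * g (j + 1) - smult 2 (pderiv (g (j + 1)))
             - smult (of_nat ((j + 1) * (n - j))) ([:1/4, 1:] * g j)" .
  qed
  have "g (n + 1) = 0" by (simp add: g_def)
  then have "n = 0" and deg: "degree (g 0) = 0"
    using terminates_imp_trivial by auto
  then obtain a where a: "g 0 = [:a:]"
    using degree_eq_zeroE by blast
  obtain b where "f = [:b:]"
    using \<open>n = 0\<close> degree_eq_zeroE unfolding n_def by blast
  with a \<open>n = 0\<close> have "f = [:[:a:]:]"
    by (simp add: g_def)
  moreover from this have "a \<noteq> 0" using f by auto
  ultimately have "1 = [:[:1 / a:]:] * f" by (simp flip: one_pCons)
  then show ?thesis
    using is_ideal_mult[OF J f(1), of "[:[:1 / a:]:]"] by simp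
qed

section \<open>The coordinate ring of the surface\<close>

definition const_B :: "'k::field \<Rightarrow> 'k B" where
  "const_B c = B_of_poly (const3 c)"

lemma scaleB_conv_mult: "scaleB c x = const_B c * x"
  by (simp add: scaleB_def const_B_def)

lemma const_B_simps [simp]:
  "const_B 0 = 0" "const_B 1 = 1"
  "const_B (a + b) = const_B a + const_B b" "const_B (a * b) = const_B a * const_B b"
  "const_B (- a) = - const_B a"
proof -
  show "const_B 0 = 0" "const_B 1 = 1"
    by (simp_all add: const_B_def const3_def B_of_poly_hom flip: one_pCons)
  show "const_B (a + b) = const_B a + const_B b" "const_B (a * b) = const_B a * const_B b"
    "const_B (- a) = - const_B a"
    unfolding const_B_def by (simp_all add: const3_def mult.commute flip: B_of_poly_hom(3,5,6))
qed

lemma const_B_of_nat [simp]: "const_B (of_nat n) = of_nat n"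
  by (induction n) simp_all

lemma B_relation: "u_B ^ 2 * w_B = v_B ^ 2 + (u_B :: 'k::field B)"
proof -
  have "B_of_poly (B_relator :: 'k poly3) = B_of_poly 0"
    by (simp add: B_of_poly_eq_iff)
  then show ?thesis
    by (simp add: B_relator_def u_B_def v_B_def w_B_def B_of_poly_hom power2_eq_square algebra_simps)
qed

lemma B_induct [case_names const u v w add mult]:
  fixes x :: "'k::field B"
  assumes const: "\<And>c. P (const_B c)" and u: "P u_B" and v: "P v_B" and w: "P w_B"
    and add: "\<And>x y. P x \<Longrightarrow> P y \<Longrightarrow> P (x + y)" and mult: "\<And>x y. P x \<Longrightarrow> P y \<Longrightarrow> P (x * y)"
  shows "P x"
proof -
  have zero: "P (B_of_poly 0)"
    using const[of 0] by (simp add: B_of_poly_hom)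
  have split: "P (B_of_poly (a + b * c))"
    if "P (B_of_poly a)" "P (B_of_poly b)" "P (B_of_poly c)" for a b c :: "'k poly3"
    unfolding B_of_poly_hom by (intro add mult that)
  have 1: "P (B_of_poly [:[:q:]:])" for q :: "'k poly"
  proof (induction q)
    case (pCons a q)
    have "[:[:pCons a q:]:] = const3 a + poly_u * [:[:q:]:]"
      by (simp add: const3_def poly_u_def)
    then show ?case
      using split[of "const3 a" poly_u "[:[:q:]:]"] const[of a] u pCons by (simp add: const_B_def u_B_def)
  qed (use zero in simp)
  have 2: "P (B_of_poly [:q:])" for q :: "'k poly poly"
  proof (induction q)
    case (pCons a q)
    have "[:pCons a q:] = [:[:a:]:] + poly_w * [:q:]"
      by (simp add: poly_w_def)
    then show ?case
      using split[of "[:[:a:]:]" poly_w "[:q:]"] 1 w pCons by (simp add: w_B_def)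
  qed (use zero in simp)
  have "P (B_of_poly q)" for q
  proof (induction q)
    case (pCons a q)
    have "pCons a q = [:a:] + poly_v * q"
      by (simp add: poly_v_def)
    then show ?case
      using split[of "[:a:]" poly_v q] 2 v pCons by (simp add: v_B_def)
  qed (use zero in simp)
  then show ?thesis
    using surj_B_of_poly by (metis surjD)
qed

text \<open>
  In k[u,v,w] the element u is prime and does not divide the relation, whose coefficient at v^2 is -1.
\<close>

lemma u_B_mult_eq_0_iff: "u_B * x = 0 \<longleftrightarrow> x = (0 :: 'k::field B)"
proof
  assume ux: "u_B * x = 0"
  obtain p :: "'k poly3" where x: "x = B_of_poly p"
    using surj_B_of_poly by (metis surjD)
  have "B_relator dvd poly_u * p"
    using ux B_of_poly_eq_iff[of "poly_u * p" 0] by (simp add: x u_B_def B_of_poly_hom)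
  then obtain q where q: "poly_u * p = B_relator * q" by (elim dvdE)
  have X: "prime_elem ([:0, 1:] :: 'k poly)"
  proof (rule prime_elemI)
    have root: "[:0, 1:] dvd p \<longleftrightarrow> poly p 0 = 0" for p :: "'k poly"
      using poly_eq_0_iff_dvd[of p 0] by simp
    show "[:0, 1:] dvd a \<or> [:0, 1:] dvd b" if "[:0, 1:] dvd a * b" for a b :: "'k poly"
      using that unfolding root by simp
  qed (auto simp: is_unit_poly_iff)
  then have prime: "prime_elem (poly_u :: 'k poly3)"
    by (simp add: poly_u_def prime_elem_const_poly_iff)
  have "\<not> poly_u dvd (B_relator :: 'k poly3)"
  proof
    assume "poly_u dvd (B_relator :: 'k poly3)"
    then have "[:[:0, 1:]:] dvd coeff (B_relator :: 'k poly3) 2"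
      unfolding poly_u_def const_poly_dvd_iff[of "[:[:0, 1:]:]"] by blast
    also have "coeff (B_relator :: 'k poly3) 2 = - 1"
      by (simp add: B_relator_def poly_u_def poly_v_def poly_w_def power2_eq_square
          coeff_pCons numeral_2_eq_2)
    finally show False
      using X prime_elem_const_poly_iff prime_elem_not_unit dvd_minus_iff by blast
  qed
  moreover have "poly_u dvd B_relator * q"
    using q by (metis dvd_triv_left)
  ultimately obtain r where r: "q = poly_u * r"
    using prime_elem_dvd_multD[OF prime] by (blast elim: dvdE)
  have "poly_u * p = poly_u * (B_relator * r)"
    unfolding q r by (simp add: mult.left_commute)
  then have "p = B_relator * r"
    using prime by (simp add: prime_elem_def)
  then show "x = 0"
    using B_of_poly_eq_iff[of p 0] by (simp add: x B_of_poly_hom)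
qed simp

section \<open>Homogenisation\<close>

definition poly_w_B :: "'k::field poly \<Rightarrow> 'k B" where
  "poly_w_B q = poly (map_poly const_B q) w_B"

lemma poly_w_B_0 [simp]: "poly_w_B 0 = 0"
  by (simp add: poly_w_B_def)

lemma poly_w_B_pCons [simp]: "poly_w_B (pCons c q) = const_B c + w_B * poly_w_B q"
  by (simp add: poly_w_B_def map_poly_pCons)

lemma poly_w_B_add [simp]: "poly_w_B (p + q) = poly_w_B p + poly_w_B q"
  by (induction p q rule: poly_induct2) (simp_all add: algebra_simps)

lemma poly_w_B_smult [simp]: "poly_w_B (smult c q) = const_B c * poly_w_B q"
  by (induction q) (simp_all add: algebra_simps)

lemma poly_w_B_mult [simp]: "poly_w_B (p * q) = poly_w_B p * poly_w_B q"
  by (induction p) (simp_all add: algebra_simps)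

lemma poly_w_B_1 [simp]: "poly_w_B 1 = 1"
  by (simp add: one_pCons)

abbreviation half_B :: "'k::field B" where
  "half_B \<equiv> const_B (1 / 2)"

lemma two_half_B: "2 * half_B = (1 :: 'k::field_char_0 B)"
proof -
  have "2 * half_B = const_B (of_nat 2 * (1 / 2 :: 'k))"
    unfolding const_B_simps const_B_of_nat by simp
  then show ?thesis by simp
qed

lemma quarter_B: "const_B (1 / 4) = half_B * (half_B :: 'k::field_char_0 B)"
  by (simp add: const_B_simps(4)[symmetric] del: const_B_simps)

text \<open>
  This is u x for the coordinate x = v / u - 1/2, in which the Riccati equation has no linear term.
\<close>

definition y_B :: "'k::field B" where
  "y_B = v_B - half_B * u_B"

text \<open>
  This is u^N p(y / u), provided that p has degree at most N.
\<close>

definition homogenise :: "nat \<Rightarrow> 'k::field poly poly \<Rightarrow> 'k B" where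
  "homogenise N p = (\<Sum>i\<le>N. poly_w_B (coeff p i) * y_B ^ i * u_B ^ (N - i))"

lemma homogenise_0 [simp]: "homogenise N 0 = 0"
  by (simp add: homogenise_def)

lemma homogenise_add [simp]: "homogenise N (p + q) = homogenise N p + homogenise N q"
  by (simp add: homogenise_def sum.distrib algebra_simps)

lemma homogenise_smult [simp]: "homogenise N (smult a p) = poly_w_B a * homogenise N p"
  by (simp add: homogenise_def sum_distrib_left algebra_simps)

lemma homogenise_const [simp]: "homogenise N [:a:] = poly_w_B a * u_B ^ N"
  by (cases N) (simp_all add: homogenise_def sum.atMost_Suc_shift del: sum.atMost_Suc)

lemma homogenise_Suc_pCons:
  "homogenise (Suc N) (pCons a p) = poly_w_B a * u_B ^ Suc N + y_B * homogenise N p"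
  by (simp add: homogenise_def sum.atMost_Suc_shift sum_distrib_left algebra_simps del: sum.atMost_Suc)

lemma homogenise_raise:
  "degree p \<le> N \<Longrightarrow> homogenise (N + k) p = u_B ^ k * homogenise N p"
proof (induction p arbitrary: N)
  case (pCons a p)
  show ?case
  proof (cases "p = 0")
    case True
    then show ?thesis by (simp add: power_add algebra_simps)
  next
    case False
    then obtain N' where "N = Suc N'" "degree p \<le> N'"
      using pCons.prems by (cases N) auto
    then show ?thesis
      using pCons.IH[of N'] by (simp add: homogenise_Suc_pCons power_add algebra_simps)
  qed
qed simp

lemma homogenise_mult:
  "degree p \<le> M \<Longrightarrow> degree q \<le> N \<Longrightarrow> homogenise (M + N) (p * q) = homogenise M p * homogenise N q"
proof (induction p arbitrary: M)
  case (pCons a p)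
  show ?case
  proof (cases "p = 0")
    case True
    then show ?thesis
      using homogenise_raise[of q N M] pCons.prems by (simp add: algebra_simps)
  next
    case False
    then obtain M' where M: "M = Suc M'" "degree p \<le> M'"
      using pCons.prems by (cases M) auto
    have "homogenise (Suc (M' + N)) (smult a q) = poly_w_B a * u_B ^ Suc M' * homogenise N q"
      using homogenise_raise[of "smult a q" N "Suc M'"] pCons.prems
      by (simp add: add_ac order.trans[OF degree_smult_le] algebra_simps)
    then show ?thesis
      using pCons.IH[of M'] pCons.prems M by (simp add: homogenise_Suc_pCons algebra_simps del: homogenise_smult)
  qed
qed simp

text \<open>
  The function 1 / u = w - (x + 1/2)^2 on the part of the surface where u is invertible.
\<close>

definition inverse_u_poly :: "'k::field poly poly" where
  "inverse_u_poly = [:[:-1/4, 1:], -1, -1:]"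

lemma degree_inverse_u_poly: "degree inverse_u_poly = 2"
  by (simp add: inverse_u_poly_def)

lemma homogenise_2:
  "homogenise 2 [:a, b, c:] = poly_w_B a * u_B ^ 2 + poly_w_B b * (y_B * u_B) + poly_w_B c * y_B ^ 2"
  by (simp add: homogenise_def numeral_2_eq_2 algebra_simps)

lemma poly_w_B_minus_1: "poly_w_B (- 1) = - 1"
  by (simp add: one_pCons)

lemma homogenise_inverse_u_poly: "homogenise 2 inverse_u_poly = (u_B :: 'k::field_char_0 B)"
proof -
  have m: "const_B (- 1 / 4) = - (half_B * half_B :: 'k B)"
    using const_B_simps(5)[of "1/4 :: 'k"] by (simp add: quarter_B)
  have "homogenise 2 inverse_u_poly
      = (u_B ^ 2 * w_B - v_B ^ 2) + (1 - 2 * half_B) * (half_B * u_B ^ 2 - u_B * (v_B :: 'k B))"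
    unfolding inverse_u_poly_def homogenise_2 poly_w_B_minus_1 poly_w_B_pCons m y_B_def
    by (simp add: power2_eq_square algebra_simps)
  then show ?thesis
    by (simp add: two_half_B B_relation)
qed

text \<open>
  On the part where u is invertible this reads x = u^j p. The degree bound 2 j, rather than j, leaves
  room for the quadratic polynomial that stands for 1 / u, so every representation can be rewritten with a larger j.
\<close>

definition homogeneous_repr :: "nat \<Rightarrow> 'k::field B \<Rightarrow> 'k poly poly \<Rightarrow> bool" where
  "homogeneous_repr j x p \<longleftrightarrow> degree p \<le> 2 * j \<and> u_B ^ j * x = homogenise (2 * j) p"

lemma homogeneous_repr_mult:
  assumes "homogeneous_repr i x p" "homogeneous_repr j y q"
  shows "homogeneous_repr (i + j) (x * y) (p * q)"
proof -
  have "u_B ^ (i + j) * (x * y) = (u_B ^ i * x) * (u_B ^ j * y)"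
    by (simp add: power_add algebra_simps)
  also have "\<dots> = homogenise (2 * i + 2 * j) (p * q)"
    using assms by (simp add: homogeneous_repr_def homogenise_mult)
  finally show ?thesis
    using assms degree_mult_le[of p q] by (simp add: homogeneous_repr_def algebra_simps)
qed

lemma homogeneous_repr_1: "homogeneous_repr j 1 (inverse_u_poly ^ j :: 'k::field_char_0 poly poly)"
proof (induction j)
  case (Suc j)
  have "homogeneous_repr 1 1 (inverse_u_poly :: 'k poly poly)"
    by (simp add: homogeneous_repr_def degree_inverse_u_poly homogenise_inverse_u_poly)
  from homogeneous_repr_mult[OF this Suc] show ?case by simp
qed (simp add: homogeneous_repr_def one_pCons)

text \<open>
  The representable elements include the generators; sums are brought to a common exponent by
  multiplying with representations of 1.
\<close>

lemma homogeneous_repr_exists: "\<exists>j p. homogeneous_repr j (x :: 'k::field_char_0 B) p"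
proof (induction x rule: B_induct)
  case (const c)
  show ?case
    by (rule exI[of _ 0], rule exI[of _ "[:[:c:]:]"]) (simp add: homogeneous_repr_def)
next
  case u
  show ?case
    by (rule exI[of _ 1], rule exI[of _ 1])
       (simp add: homogeneous_repr_def one_pCons power2_eq_square)
next
  case v
  have "homogenise 2 [:[:1/2:], 1:] = u_B * (v_B :: 'k B)"
    using homogenise_2[of "[:1/2:]" 1 "0 :: 'k poly"]
    by (simp add: y_B_def algebra_simps power2_eq_square)
  then show ?case
    by (intro exI[of _ 1] exI[of _ "[:[:1/2:], 1:]"]) (simp add: homogeneous_repr_def)
next
  case w
  show ?case
    by (rule exI[of _ 0], rule exI[of _ "[:[:0, 1:]:]"]) (simp add: homogeneous_repr_def)
next
  case (add x y)
  then obtain i p j q where x: "homogeneous_repr i x p" and y: "homogeneous_repr j y q"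
    by blast
  have "homogeneous_repr (i + j) x (inverse_u_poly ^ j * p)"
    "homogeneous_repr (i + j) y (inverse_u_poly ^ i * q)"
    using homogeneous_repr_mult[OF homogeneous_repr_1 x, of j]
      homogeneous_repr_mult[OF homogeneous_repr_1 y, of i] by (simp_all add: add.commute)
  then have "homogeneous_repr (i + j) (x + y) (inverse_u_poly ^ j * p + inverse_u_poly ^ i * q)"
    by (simp add: homogeneous_repr_def degree_add_le distrib_left)
  then show ?case by blast
next
  case (mult x y)
  then show ?case using homogeneous_repr_mult by blast
qed

section \<open>Stable ideals of the surface\<close>

context
  fixes D :: "'k::field_char_0 B \<Rightarrow> 'k B"
  assumes D: "is_calD D"
begin

lemma calD_derivation: "is_derivation D"
  using D by (auto simp: is_calD_def Der_def Vector_Spaces.linear_iff is_derivation_def)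

lemma calD_const [simp]: "D (const_B c) = 0"
proof -
  have "D (scaleB c 1) = scaleB c (D 1)"
    using D by (auto simp: is_calD_def Der_def Vector_Spaces.linear_iff)
  then show ?thesis
    by (simp add: scaleB_conv_mult is_derivation_one[OF calD_derivation])
qed

lemma calD_w: "D w_B = 1"
  and calD_u: "D u_B = v_B + u_B ^ 2 * w_B - u_B - u_B ^ 2"
  and calD_v: "D v_B = u_B * v_B * w_B - u_B * v_B + u_B * w_B - half_B * (v_B + 1)"
  using D by (simp_all add: is_calD_def scaleB_conv_mult)

lemma calD_add: "D (a + b) = D a + D b"
  and calD_mult: "D (a * b) = D a * b + a * D b"
  using calD_derivation by (simp_all add: is_derivation_def)

lemma calD_poly_w: "D (poly_w_B q) = poly_w_B (pderiv q)"
  by (induction q) (simp_all add: calD_add calD_mult calD_w pderiv_pCons is_derivation_zero[OF calD_derivation] algebra_simps)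

text \<open>
  Divided by u^2, this is the Riccati equation 2 x' = z - x^2 for x = y / u.
\<close>

lemma calD_wronskian:
  "2 * (u_B * D y_B - y_B * D u_B) = poly_w_B [:1/4, 1:] * u_B ^ 2 - y_B ^ 2"
proof -
  have Dy: "D y_B = D v_B - half_B * D u_B"
    by (simp add: y_B_def is_derivation_diff[OF calD_derivation] calD_mult)
  have "2 * (u_B * D y_B - y_B * D u_B) = 2 * (u_B * D v_B - v_B * D u_B)"
    unfolding Dy by (simp add: y_B_def algebra_simps)
  also have "\<dots> = 2 * (u_B ^ 2 * w_B - v_B ^ 2) + 2 * u_B * v_B - (2 * half_B) * (u_B + u_B * v_B)"
    unfolding calD_u calD_v by (simp add: power2_eq_square algebra_simps)
  also have "\<dots> = u_B + u_B * v_B"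
    by (simp add: two_half_B B_relation)
  also have "\<dots> = (u_B ^ 2 * w_B - v_B ^ 2) + (2 * half_B) * u_B * v_B"
    by (simp add: two_half_B B_relation)
  also have "\<dots> = poly_w_B [:1/4, 1:] * u_B ^ 2 - y_B ^ 2"
    by (simp add: quarter_B y_B_def power2_eq_square algebra_simps)
  finally show ?thesis .
qed

text \<open>
  The product rule for u^N p(x): the first summand comes from p and the second from u^N. The factor 2 u on the left
  clears the denominators of D(x).
\<close>

lemma calD_homogenise:
  "degree p \<le> N \<Longrightarrow> 2 * u_B * D (homogenise N p) =
     homogenise (Suc N) (riccati_derivation p) + 2 * of_nat N * D u_B * homogenise N p"
proof (induction p arbitrary: N)
  case 0
  then show ?case by (simp add: is_derivation_zero[OF calD_derivation] riccati_derivation_def)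
next
  case (pCons a p)
  have ric: "riccati_derivation (pCons a p) = [:smult 2 (pderiv a):]
      + ([:[:1/4, 1:], 0, -1:] * p + pCons 0 (riccati_derivation p))"
  proof -
    have "smult 2 (map_poly pderiv (pCons a p)) + q * pderiv (pCons a p) = [:smult 2 (pderiv a):]
        + (q * p + pCons 0 (smult 2 (map_poly pderiv p) + q * pderiv p))" for q
      by (simp add: map_poly_pCons pderiv_pCons distrib_left) (simp add: numeral_poly)
    then show ?thesis unfolding riccati_derivation_def .
  qed
  have pow: "u_B * D (u_B ^ N) = of_nat N * u_B ^ N * D u_B" for N
    unfolding is_derivation_power[OF calD_derivation] by (cases N) (simp_all add: algebra_simps)
  have two: "const_B 2 = (2 :: 'k B)"
    using const_B_of_nat[of 2] by simp
  show ?case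
  proof (cases "p = 0")
    case True
    have "2 * u_B * D (poly_w_B a * u_B ^ N) = 2 * poly_w_B (pderiv a) * u_B ^ Suc N
        + 2 * poly_w_B a * (u_B * D (u_B ^ N))"
      by (simp add: calD_mult calD_poly_w algebra_simps)
    then show ?thesis
      unfolding pow ric using True
      by (simp add: riccati_derivation_def two algebra_simps)
  next
    case False
    then obtain M where N: "N = Suc M" and M: "degree p \<le> M"
      using pCons.prems by (cases N) auto
    have quad: "homogenise (Suc (Suc M)) ([:[:1/4, 1:], 0, -1:] * p)
        = 2 * (u_B * D y_B - y_B * D u_B) * homogenise M p"
      using homogenise_mult[of "[:[:1/4, 1:], 0, -1:]" 2 p M] M
      unfolding calD_wronskian homogenise_2 poly_w_B_minus_1 by simp
    have "2 * u_B * D (homogenise N (pCons a p)) =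
        2 * poly_w_B (pderiv a) * u_B ^ Suc N + 2 * poly_w_B a * (u_B * D (u_B ^ N))
          + 2 * u_B * D y_B * homogenise M p + y_B * (2 * u_B * D (homogenise M p))"
      unfolding N homogenise_Suc_pCons
      by (simp add: calD_add calD_mult calD_poly_w algebra_simps del: power_Suc) 
        (simp add: algebra_simps)
    also have "\<dots> = homogenise (Suc N) (riccati_derivation (pCons a p))
        + 2 * of_nat N * D u_B * homogenise N (pCons a p)"
      unfolding pow ric pCons.IH[OF M] homogenise_add unfolding N quad homogenise_Suc_pCons
      by (simp add: two algebra_simps)
    finally show ?thesis .
  qed
qed

text \<open>
  The polynomials with some homogenisation in I are the contraction to k[w][x] of the extension of I to the
  part where u is invertible.
\<close>

lemma riccati_ideal_of_stable_ideal:
  assumes I: "is_ideal I" and stable: "D ` I \<subseteq> I"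
  defines "J \<equiv> {p. \<exists>N. degree p \<le> N \<and> homogenise N p \<in> I}"
  shows "is_ideal J" and "riccati_derivation ` J \<subseteq> J"
proof -
  have add: "p + q \<in> J" if pq: "p \<in> J" "q \<in> J" for p q
  proof -
    obtain M N where M: "degree p \<le> M" "homogenise M p \<in> I" and N: "degree q \<le> N" "homogenise N q \<in> I"
      using pq by (auto simp: J_def)
    have "homogenise (M + N) p \<in> I" "homogenise (M + N) q \<in> I"
      using homogenise_raise[OF M(1), of N] homogenise_raise[OF N(1), of M]
        is_ideal_mult[OF I M(2)] is_ideal_mult[OF I N(2)] by (simp_all add: add.commute)
    then have "homogenise (M + N) (p + q) \<in> I"
      using is_ideal_add[OF I] by simp
    moreover have "degree (p + q) \<le> M + N"
      using M N by (intro degree_add_le) auto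
    ultimately show ?thesis by (auto simp: J_def)
  qed
  have mult: "r * p \<in> J" if p: "p \<in> J" for r p
  proof -
    obtain N where N: "degree p \<le> N" "homogenise N p \<in> I"
      using p by (auto simp: J_def)
    have "homogenise (degree r + N) (r * p) \<in> I"
      unfolding homogenise_mult[OF order.refl N(1)] by (rule is_ideal_mult[OF I N(2)])
    moreover have "degree (r * p) \<le> degree r + N"
      using degree_mult_le[of r p] N by simp
    ultimately show ?thesis by (auto simp: J_def)
  qed
  have "0 \<in> J" using I by (auto simp: J_def is_ideal_def)
  with add mult show "is_ideal J" by (simp add: is_ideal_def)
  have "riccati_derivation p \<in> J" if p: "p \<in> J" for p
  proof -
    obtain N where N: "degree p \<le> N" "homogenise N p \<in> I"
      using p by (auto simp: J_def)
    have "homogenise (Suc N) (riccati_derivation p)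
        = 2 * u_B * D (homogenise N p) - 2 * of_nat N * D u_B * homogenise N p"
      using calD_homogenise[OF N(1)] by simp
    also have "\<dots> \<in> I"
      using is_ideal_mult[OF I N(2)] is_ideal_mult[OF I] stable N(2) by (intro is_ideal_diff[OF I]) auto
    finally have "homogenise (Suc N) (riccati_derivation p) \<in> I" .
    moreover have "degree (riccati_derivation p) \<le> Suc N"
    proof (intro degree_le allI impI)
      fix i assume "i > Suc N"
      then obtain l where l: "i = Suc l" "l > N" by (cases i) auto
      then have "coeff p l = 0" "coeff p (Suc l) = 0" "coeff p (Suc (Suc l)) = 0"
        using N(1) by (auto intro: coeff_eq_0)
      then show "coeff (riccati_derivation p) i = 0"
        using coeff_riccati_derivation_add[of p 0 i] l by simp
    qed
    ultimately show ?thesis by (auto simp: J_def)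
  qed
  then show "riccati_derivation ` J \<subseteq> J" by blast
qed

text \<open>
  The case distinction says whether I remains proper after inverting u. If it does, then it is zero
  by simplicity on the plane. Otherwise a proper I would be supported at the points with u = v = 0, and there D(v) = -1/2 does not vanish.
\<close>

lemma calD_simple: "simple_derivation D"
  unfolding simple_derivation_def
proof (intro allI impI, elim conjE)
  fix I :: "'k B set"
  assume I: "is_ideal I" and stable: "D ` I \<subseteq> I"
  define J where "J = {p. \<exists>N. degree p \<le> N \<and> homogenise N p \<in> I}"
  have J: "is_ideal J" "riccati_derivation ` J \<subseteq> J"
    unfolding J_def by (rule riccati_ideal_of_stable_ideal[OF I stable])+
  show "I = {0} \<or> I = UNIV"
  proof (cases "J = {0}")
    case True
    have "x = 0" if x: "x \<in> I" for x
    proof -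
      obtain j p where jp: "degree p \<le> 2 * j" "u_B ^ j * x = homogenise (2 * j) p"
        using homogeneous_repr_exists[of x] by (auto simp: homogeneous_repr_def)
      then have "p \<in> J"
        using is_ideal_mult[OF I x, of "u_B ^ j"] by (auto simp: J_def)
      then have "u_B ^ j * x = 0"
        using True jp by simp
      then show "x = 0"
        by (induction j) (simp_all add: mult.assoc u_B_mult_eq_0_iff)
    qed
    then show ?thesis using I by (auto simp: is_ideal_def)
  next
    case False
    then have "1 \<in> J"
      using riccati_derivation_simple J by blast
    then obtain N where "u_B ^ N \<in> I"
      by (auto simp: J_def one_pCons)
    let ?R = "radical_of I"
    have R: "is_ideal ?R" by (rule is_ideal_radical[OF I])
    have u: "u_B \<in> ?R"
      using \<open>u_B ^ N \<in> I\<close> by (auto simp: radical_of_def)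
    have "v_B ^ 2 = (u_B * w_B - 1) * (u_B :: 'k B)"
      using B_relation[where 'k = 'k] by (simp add: power2_eq_square algebra_simps)
    then have "v_B ^ 2 \<in> ?R"
      using is_ideal_mult[OF R u] by simp
    then obtain n where "v_B ^ (2 * n) \<in> I"
      by (auto simp: radical_of_def power_mult)
    then have v: "v_B \<in> ?R"
      by (auto simp: radical_of_def)
    have "\<exists>r. r * of_nat n = (1 :: 'k B)" if "n > 0" for n
    proof -
      have "const_B (1 / of_nat n) * of_nat n = const_B (1 / of_nat n * of_nat n :: 'k)"
        unfolding const_B_simps const_B_of_nat ..
      then show ?thesis using that by auto
    qed
    then have Dv: "D v_B \<in> ?R"
      by (rule derivation_maps_radical[OF I calD_derivation stable _ v])
    \<comment> \<open>D(v) is congruent to -1/2 modulo u and v.\<close>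
    have "1 = (2 * half_B) * (1 :: 'k B)" by (simp add: two_half_B)
    also have "\<dots> = 2 * (v_B * w_B - v_B + w_B) * u_B - v_B - 2 * D v_B"
      unfolding calD_v using two_half_B[where 'k = 'k] by (simp add: algebra_simps)
    also have "\<dots> \<in> ?R"
      using is_ideal_mult[OF R] is_ideal_diff[OF R] u v Dv by metis
    finally have "1 \<in> I" by (auto simp: radical_of_def)
    then show ?thesis
      using is_ideal_mult[OF I, of 1] by auto
  qed
qed

end

section \<open>Existence and uniqueness of the derivation\<close>

lemma calD_unique:
  assumes D: "is_calD D" and E: "is_calD E"
  shows "D = (E :: 'k::field_char_0 B \<Rightarrow> 'k B)"
proof
  show "D x = E x" for x
    by (induction x rule: B_induct)
      (simp_all add: calD_const calD_u calD_v calD_w calD_add calD_mult D E)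
qed

text \<open>
  The derivation of k[u][w][v] with the prescribed values on the variables; the partial derivatives
  with respect to v, w and u act on the outer, middle and inner coefficients.
\<close>

definition calD_lift :: "'k::field_char_0 poly3 \<Rightarrow> 'k poly3" where
  "calD_lift p =
     (poly_u * poly_v * poly_w - poly_u * poly_v + poly_u * poly_w - const3 (1 / 2) * (poly_v + 1)) * pderiv p
     + map_poly pderiv p
     + (poly_v + poly_u ^ 2 * poly_w - poly_u - poly_u ^ 2) * map_poly (map_poly pderiv) p"

lemma calD_lift_derivation: "is_derivation calD_lift"
  unfolding calD_lift_def
  by (intro is_derivation_add is_derivation_scale is_derivation_map_poly is_derivation_pderiv)

lemma calD_lift_generators:
  fixes c :: "'k::field_char_0"
  shows
  "calD_lift (const3 c) = 0"
  "calD_lift (poly_w :: 'k poly3) = 1"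
  "calD_lift (poly_u :: 'k poly3) = poly_v + poly_u ^ 2 * poly_w - poly_u - poly_u ^ 2"
  "calD_lift (poly_v :: 'k poly3) = poly_u * poly_v * poly_w - poly_u * poly_v + poly_u * poly_w
     - const3 (1 / 2) * (poly_v + 1)"
proof -
  have
    "pderiv (const3 c) = 0" "map_poly pderiv (const3 c) = 0" "map_poly (map_poly pderiv) (const3 c) = 0"
    "pderiv (poly_u :: 'k poly3) = 0" "map_poly pderiv (poly_u :: 'k poly3) = 0"
    "map_poly (map_poly pderiv) (poly_u :: 'k poly3) = 1"
    "pderiv (poly_w :: 'k poly3) = 0" "map_poly pderiv (poly_w :: 'k poly3) = 1"
    "map_poly (map_poly pderiv) (poly_w :: 'k poly3) = 0"
    "pderiv (poly_v :: 'k poly3) = 1" "map_poly pderiv (poly_v :: 'k poly3) = 0"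
    "map_poly (map_poly pderiv) (poly_v :: 'k poly3) = 0"
    by (simp_all add: const3_def poly_u_def poly_v_def poly_w_def map_poly_pCons map_poly_1 pderiv_pCons flip: one_pCons)
  then show
    "calD_lift (const3 c) = 0"
    "calD_lift (poly_w :: 'k poly3) = 1"
    "calD_lift (poly_u :: 'k poly3) = poly_v + poly_u ^ 2 * poly_w - poly_u - poly_u ^ 2"
    "calD_lift (poly_v :: 'k poly3) = poly_u * poly_v * poly_w - poly_u * poly_v + poly_u * poly_w
     - const3 (1 / 2) * (poly_v + 1)"
    by (simp_all add: calD_lift_def)
qed

lemma calD_lift_relator:
  "calD_lift B_relator = (2 * poly_u * poly_w - 2 * poly_u - 1) * (B_relator :: 'k::field_char_0 poly3)"
proof -
  have half: "2 * const3 (1 / 2) = (1 :: 'k poly3)"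
    by (simp add: const3_def numeral_poly flip: one_pCons)
  note d = calD_lift_derivation
  have "calD_lift B_relator = 2 * poly_u * calD_lift poly_u * poly_w + poly_u ^ 2 * calD_lift poly_w
      - 2 * poly_v * calD_lift poly_v - calD_lift (poly_u :: 'k poly3)"
    unfolding B_relator_def
    by (simp add: is_derivation_diff[OF d] is_derivation_mult[OF d] is_derivation_power[OF d])
  also have "\<dots> = (2 * poly_u * poly_w - 2 * poly_u - 1) * B_relator
     + (2 * const3 (1 / 2) - 1) * (poly_v * (poly_v + 1))"
    unfolding calD_lift_generators B_relator_def by (simp add: power2_eq_square algebra_simps)
  finally show ?thesis by (simp add: half)
qed

lemma calD_exists: "\<exists>D :: 'k::field_char_0 B \<Rightarrow> 'k B. is_calD D"
proof -
  note d = calD_lift_derivation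
  define D :: "'k B \<Rightarrow> 'k B" where "D x = B_of_poly (calD_lift (rep_B x))" for x
  have rep: "B_of_poly (rep_B x) = x" for x :: "'k B"
    unfolding B_of_poly_def by (rule Quotient_abs_rep[OF Quotient_B])
  have D: "D (B_of_poly p) = B_of_poly (calD_lift p)" for p
  proof -
    obtain q where "rep_B (B_of_poly p) - p = B_relator * q"
      using B_of_poly_eq_iff[of "rep_B (B_of_poly p)" p] by (auto simp: rep)
    then have "calD_lift (rep_B (B_of_poly p)) - calD_lift p = calD_lift (B_relator * q)"
      by (simp flip: is_derivation_diff[OF d])
    then have "B_relator dvd calD_lift (rep_B (B_of_poly p)) - calD_lift p"
      by (simp add: is_derivation_mult[OF d] calD_lift_relator)
    then show ?thesis
      unfolding D_def by (simp add: B_of_poly_eq_iff)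
  qed
  have add: "D (x + y) = D x + D y" and mult: "D (x * y) = D x * y + x * D y" for x y
  proof -
    obtain p q where pq: "x = B_of_poly p" "y = B_of_poly q"
      using rep by metis
    show "D (x + y) = D x + D y"
      unfolding pq B_of_poly_hom(3)[symmetric] D
      by (simp add: is_derivation_plus[OF d] B_of_poly_hom D)
    show "D (x * y) = D x * y + x * D y"
      unfolding pq B_of_poly_hom(6)[symmetric] D
      by (simp add: is_derivation_mult[OF d] B_of_poly_hom D)
  qed
  have "D (scaleB c x) = scaleB c (D x)" for c x
    unfolding scaleB_def mult D calD_lift_generators by (simp add: B_of_poly_hom)
  then have "D \<in> Der scaleB"
    unfolding Der_def by (simp add: Vector_Spaces.linear_iff vector_space_scaleB add mult)
  then have "is_calD D"
    unfolding is_calD_def scaleB_def u_B_def v_B_def w_B_def D calD_lift_generators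
    by (simp add: B_of_poly_hom power2_eq_square)
  then show ?thesis by blast
qed

theorem proposition26:
  "(\<exists>!D :: 'k::{alg_closed_field, field_char_0} B \<Rightarrow> 'k B. is_calD D) \<and>
   (\<forall>D :: 'k B \<Rightarrow> 'k B. is_calD D \<longrightarrow> simple_derivation D)"
  using calD_exists calD_unique calD_simple by blast

end
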